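(* Let $n\in\mathbb{N}$, $t_0\in\mathbb{N}$, and let $\{W(t)\}$ be a sequence of random $n\times n$ matrices adapted to a filtration $\{\mathcal{F}(t)\}$, with $W(t)$ row-stochastic almost surely for all $t\ge t_0$. Fix $\gamma\in(0,1)$ and assume that for all $t\ge t_0$: (a) every node of $\mathcal{G}(W(t))$ has a self-loop almost surely; (b) there is an integer $B>0$, independent of $t$, such that the random graph $([n],\mathcal{E}_B(t))$ with $\mathcal{E}_B(t)=\bigcup_{\tau=tB+1}^{(t+1)B}\mathcal{E}(\mathbb{E}[W(\tau)\mid\mathcal{F}(tB)])$ has a spanning rooted tree almost surely. Then there exist constants $C>0$ and $0\le\lambda<1$ such that for every $t_0\le\tau_1\le t_1$ and $t_0\le\tau_2\le t_2$ with $\tau_1\le\tau_2$, almost surely $$\mathbb{E}\big[\mathrm{diam}(\Phi(t_2,\tau_2))\,\mathrm{diam}(\Phi(t_1,\tau_1))\mid\mathcal{F}(\tau_1)\big]\le C\lambda^{t_1-\tau_1}\lambda^{t_2-\tau_2}.$$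
   Context: $[n]=\{1,\dots,n\}$. A filtration is an increasing sequence of sigma-algebras $\mathcal{F}(0)\subseteq\mathcal{F}(1)\subseteq\cdots$; adapted means $W(t)$ is $\mathcal{F}(t)$-measurable for every $t$. For an $n\times n$ matrix $A=[a_{ij}]$, $\mathcal{G}(A)=([n],\mathcal{E}(A))$ is the directed graph with edge set $\mathcal{E}(A)=\{(j,i): i,j\in[n],\ a_{ij}>\gamma\}$. A directed graph on $[n]$ has a spanning rooted tree if there is a vertex $r$ from which there is a directed path to every other vertex. Transition matrices: $\Phi(t,\tau)=W(t)W(t-1)\cdots W(\tau+1)$ for $t>\tau$ and $\Phi(\tau,\tau)=I$. For a matrix $A$, $\mathrm{diam}(A)=\max_{i,j\in[n]}\frac12\sum_{\ell=1}^n|a_{i\ell}-a_{j\ell}|$. *)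

theory Defs
  imports "HOL-Probability.Probability"
begin

definition row_stochastic :: "real ^ 'n ^ 'n \<Rightarrow> bool" where
  "row_stochastic A \<longleftrightarrow> (\<forall>i j. 0 \<le> A $ i $ j) \<and> (\<forall>i. (\<Sum>j\<in>UNIV. A $ i $ j) = 1)"

text \<open>The vertex set is the whole (finite, nonempty) index type, so a directed graph is given by
  its edge relation.  Note the reversal: an entry in row i, column j is an edge from j to i.\<close>

definition graph_edges :: "real \<Rightarrow> real ^ 'n ^ 'n \<Rightarrow> ('n \<times> 'n) set" where
  "graph_edges \<gamma> A = {(j, i). A $ i $ j > \<gamma>}"

definition has_spanning_rooted_tree :: "('n \<times> 'n) set \<Rightarrow> bool" where
  "has_spanning_rooted_tree E \<longleftrightarrow> (\<exists>r. \<forall>v. (r, v) \<in> E\<^sup>*)"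

definition mat_cond_exp ::
  "'a measure \<Rightarrow> 'a measure \<Rightarrow> ('a \<Rightarrow> real ^ 'n ^ 'n) \<Rightarrow> 'a \<Rightarrow> real ^ 'n ^ 'n" where
  "mat_cond_exp M F X \<omega> = (\<chi> i j. real_cond_exp M F (\<lambda>\<omega>'. X \<omega>' $ i $ j) \<omega>)"

definition window_edges ::
  "'a measure \<Rightarrow> (nat \<Rightarrow> 'a measure) \<Rightarrow> (nat \<Rightarrow> 'a \<Rightarrow> real ^ 'n ^ 'n) \<Rightarrow> real \<Rightarrow> nat \<Rightarrow> nat \<Rightarrow> 'a
    \<Rightarrow> ('n \<times> 'n) set" where
  "window_edges M F W \<gamma> B t \<omega> =
     (\<Union>\<tau>\<in>{t * B + 1..(t + 1) * B}. graph_edges \<gamma> (mat_cond_exp M (F (t * B)) (W \<tau>) \<omega>))"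

text \<open>The product \<open>A t ** \<dots> ** A (\<tau> + 1)\<close>, with the most recent factor on the left; the value for
  \<open>t < \<tau>\<close> is immaterial.\<close>

fun transition :: "(nat \<Rightarrow> real ^ 'n ^ 'n) \<Rightarrow> nat \<Rightarrow> nat \<Rightarrow> real ^ 'n ^ 'n" where
  "transition A 0 \<tau> = mat 1"
| "transition A (Suc t) \<tau> = (if \<tau> \<le> t then A (Suc t) ** transition A t \<tau> else mat 1)"

definition mat_diam :: "real ^ 'n ^ 'n \<Rightarrow> real" where
  "mat_diam A = (MAX (i, j)\<in>UNIV. 1 / 2 * (\<Sum>l\<in>UNIV. \<bar>A $ i $ l - A $ j $ l\<bar>))"

end

theory Submission
  imports Defs
begin

text \<open>The diameter is submultiplicative on row-stochastic matrices, so it suffices to contract it in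
  conditional expectation over a block of windows.  Follow, for every vertex \<open>l\<close>, the set of rows in
  which column \<open>l\<close> of the running product is not too small.  Self-loops prevent these sets from
  shrinking.  In each window, conditionally on the past, either the set of the root is already
  everything, or an edge leaves it and is realised with conditional probability bounded below, so that
  the total size grows by one.  After \<open>CARD('n) ^ 2\<close> consecutive successes some column is bounded below
  by a positive constant, which bounds the diameter away from 1.  Overlapping time intervals only cost
  a square root of the rate.\<close>

subsection \<open>Diameters of stochastic matrices\<close>

lemma row_sum_dist_le_mat_diam:
  "(\<Sum>l\<in>UNIV. \<bar>A $ i $ l - A $ j $ l\<bar>) \<le> 2 * mat_diam A"
proof -
  have "1 / 2 * (\<Sum>l\<in>UNIV. \<bar>A $ i $ l - A $ j $ l\<bar>) \<le> mat_diam A"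
    unfolding mat_diam_def by (rule Max_ge) (auto intro!: image_eqI[where x = "(i, j)"])
  then show ?thesis by simp
qed

lemma mat_diam_leI:
  assumes "\<And>i j. (\<Sum>l\<in>UNIV. \<bar>A $ i $ l - A $ j $ l\<bar>) \<le> 2 * c"
  shows "mat_diam A \<le> c"
  unfolding mat_diam_def using assms by (subst Max_le_iff) (auto simp: field_simps)

lemma mat_diam_nonneg: "0 \<le> mat_diam A"
  using row_sum_dist_le_mat_diam[of A undefined undefined] by simp

text \<open>Splitting \<open>p\<close> into its positive and negative parts, of common mass \<open>s\<close>, one has
  \<open>s * (\<Sum>k. p k * B k l) = (\<Sum>i j. p\<^sup>+ i * p\<^sup>- j * (B i l - B j l))\<close>.\<close>

lemma sum_zero_vec_mult_le:
  fixes p :: "'n::finite \<Rightarrow> real" and B :: "real ^ 'n ^ 'n"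
  assumes "(\<Sum>k\<in>UNIV. p k) = 0"
  shows "(\<Sum>l\<in>UNIV. \<bar>\<Sum>k\<in>UNIV. p k * B $ k $ l\<bar>) \<le> (\<Sum>k\<in>UNIV. \<bar>p k\<bar>) * mat_diam B"
proof -
  define P N where "P k = max (p k) 0" and "N k = max (- p k) 0" for k
  define s where "s = (\<Sum>k\<in>UNIV. P k)"
  have nn: "0 \<le> P k" "0 \<le> N k" for k by (auto simp: P_def N_def)
  have p: "p k = P k - N k" and ab: "\<bar>p k\<bar> = P k + N k" for k by (auto simp: P_def N_def)
  have sN: "(\<Sum>k\<in>UNIV. N k) = s"
    using assms by (simp add: p sum_subtractf s_def)
  have mass: "(\<Sum>k\<in>UNIV. \<bar>p k\<bar>) = 2 * s"
    by (simp add: ab sum.distrib sN s_def)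
  have s0: "0 \<le> s" unfolding s_def by (intro sum_nonneg nn)
  have split: "s * (\<Sum>k\<in>UNIV. p k * B $ k $ l) =
      (\<Sum>i\<in>UNIV. \<Sum>j\<in>UNIV. P i * N j * (B $ i $ l - B $ j $ l))" for l
  proof -
    have "(\<Sum>i\<in>UNIV. \<Sum>j\<in>UNIV. P i * N j * (B $ i $ l - B $ j $ l)) =
        (\<Sum>i\<in>UNIV. \<Sum>j\<in>UNIV. P i * B $ i $ l * N j) - (\<Sum>i\<in>UNIV. \<Sum>j\<in>UNIV. P i * (N j * B $ j $ l))"
      by (simp add: sum_subtractf[symmetric] algebra_simps)
    also have "\<dots> = (\<Sum>i\<in>UNIV. P i * B $ i $ l) * s - s * (\<Sum>j\<in>UNIV. N j * B $ j $ l)"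
      by (simp only: sum_product[symmetric] sN s_def[symmetric])
    also have "\<dots> = s * (\<Sum>k\<in>UNIV. p k * B $ k $ l)"
      by (simp add: p left_diff_distrib sum_subtractf right_diff_distrib)
    finally show ?thesis ..
  qed
  have "s * (\<Sum>l\<in>UNIV. \<bar>\<Sum>k\<in>UNIV. p k * B $ k $ l\<bar>) =
      (\<Sum>l\<in>UNIV. \<bar>s * (\<Sum>k\<in>UNIV. p k * B $ k $ l)\<bar>)"
    using s0 by (simp add: abs_mult flip: sum_distrib_left)
  also have "\<dots> \<le> (\<Sum>l\<in>UNIV. \<Sum>i\<in>UNIV. \<Sum>j\<in>UNIV. P i * N j * \<bar>B $ i $ l - B $ j $ l\<bar>)"
    unfolding split
    by (intro sum_mono order_trans[OF sum_abs]) (simp add: abs_mult nn)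
  also have "\<dots> = (\<Sum>i\<in>UNIV. \<Sum>j\<in>UNIV. P i * N j * (\<Sum>l\<in>UNIV. \<bar>B $ i $ l - B $ j $ l\<bar>))"
    unfolding sum_distrib_left by (subst sum.swap, rule sum.cong[OF refl], rule sum.swap)
  also have "\<dots> \<le> (\<Sum>i\<in>UNIV. \<Sum>j\<in>UNIV. P i * N j * (2 * mat_diam B))"
    by (intro sum_mono mult_left_mono row_sum_dist_le_mat_diam mult_nonneg_nonneg nn)
  also have "\<dots> = s * (2 * s * mat_diam B)"
    by (simp add: sum_distrib_right[symmetric] sum_distrib_left[symmetric] sN s_def[symmetric])
  finally have *: "s * (\<Sum>l\<in>UNIV. \<bar>\<Sum>k\<in>UNIV. p k * B $ k $ l\<bar>) \<le> s * (2 * s * mat_diam B)" .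
  show ?thesis
  \<comment> \<open>The common mass \<open>s\<close> is to be cancelled; if it is zero, then
    \<open>p\<close> vanishes identically.\<close>
  proof (cases "s = 0")
    case True
    then have "\<bar>p k\<bar> = 0" for k
      using mass sum_nonneg_eq_0_iff[of UNIV "\<lambda>k. \<bar>p k\<bar>"] by simp
    then show ?thesis by simp
  next
    case False
    then show ?thesis using * s0 mass by simp
  qed
qed

text \<open>Two rows of \<open>A\<close> have the same sum, so their difference is a zero-sum vector
  of l1 norm at most \<open>2 * mat_diam A\<close>, and multiplying it by \<open>B\<close> gives the
  corresponding row difference of the product.\<close>

lemma mat_diam_mult_le:
  fixes A B :: "real ^ 'n ^ 'n"
  assumes "row_stochastic A"
  shows "mat_diam (A ** B) \<le> mat_diam A * mat_diam B"
proof (rule mat_diam_leI)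
  fix i j
  have "(\<Sum>l\<in>UNIV. \<bar>(A ** B) $ i $ l - (A ** B) $ j $ l\<bar>) =
      (\<Sum>l\<in>UNIV. \<bar>\<Sum>k\<in>UNIV. (A $ i $ k - A $ j $ k) * B $ k $ l\<bar>)"
    by (simp add: matrix_matrix_mult_def left_diff_distrib sum_subtractf)
  also have "\<dots> \<le> (\<Sum>k\<in>UNIV. \<bar>A $ i $ k - A $ j $ k\<bar>) * mat_diam B"
    using assms by (intro sum_zero_vec_mult_le) (simp add: sum_subtractf row_stochastic_def)
  also have "\<dots> \<le> 2 * mat_diam A * mat_diam B"
    by (intro mult_right_mono row_sum_dist_le_mat_diam mat_diam_nonneg)
  finally show "(\<Sum>l\<in>UNIV. \<bar>(A ** B) $ i $ l - (A ** B) $ j $ l\<bar>) \<le>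
      2 * (mat_diam A * mat_diam B)" by simp
qed

text \<open>Half the l1 distance of two probability vectors is 1 minus their overlap, the sum of the
  entrywise minima. Column \<open>l\<close> alone contributes at least \<open>d\<close> to the
  overlap of any two rows.\<close>

lemma mat_diam_le_of_column:
  assumes "row_stochastic A" "0 \<le> d" "\<And>i. d \<le> A $ i $ l"
  shows "mat_diam A \<le> 1 - d"
proof (rule mat_diam_leI)
  fix i j
  have nn: "0 \<le> A $ i $ k" "0 \<le> A $ j $ k" for k
    using assms(1) by (auto simp: row_stochastic_def)
  have "d \<le> min (A $ i $ l) (A $ j $ l)" using assms(3) by simp
  also have "\<dots> \<le> (\<Sum>k\<in>UNIV. min (A $ i $ k) (A $ j $ k))"
    by (rule member_le_sum) (auto simp: nn)
  finally have "d \<le> (\<Sum>k\<in>UNIV. min (A $ i $ k) (A $ j $ k))" .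
  moreover have "(\<Sum>k\<in>UNIV. \<bar>A $ i $ k - A $ j $ k\<bar>) =
      (\<Sum>k\<in>UNIV. A $ i $ k + A $ j $ k - 2 * min (A $ i $ k) (A $ j $ k))"
    by (rule sum.cong) auto
  moreover have "\<dots> = 2 - 2 * (\<Sum>k\<in>UNIV. min (A $ i $ k) (A $ j $ k))"
    using assms(1) by (simp add: sum_subtractf sum.distrib sum_distrib_left row_stochastic_def)
  ultimately show "(\<Sum>k\<in>UNIV. \<bar>A $ i $ k - A $ j $ k\<bar>) \<le> 2 * (1 - d)" by simp
qed

lemma mat_diam_le_1: "row_stochastic A \<Longrightarrow> mat_diam A \<le> 1"
  using mat_diam_le_of_column[of A 0] by (simp add: row_stochastic_def)

section \<open>Products of row-stochastic matrices and lower bounds on their entries\<close>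

lemma row_stochastic_mult:
  assumes "row_stochastic A" "row_stochastic B"
  shows "row_stochastic (A ** B)"
proof -
  have "(\<Sum>j\<in>UNIV. \<Sum>k\<in>UNIV. A $ i $ k * B $ k $ j) = 1" for i
    using assms by (subst sum.swap) (simp add: sum_distrib_left[symmetric] row_stochastic_def)
  then show ?thesis
    using assms by (auto simp: row_stochastic_def matrix_matrix_mult_def intro!: sum_nonneg)
qed

lemma row_stochastic_mat_1: "row_stochastic (mat 1)"
  by (simp add: row_stochastic_def mat_def)

text \<open>The product entry is a sum of nonnegative terms, one for each intermediate vertex; only
  the path through \<open>k\<close> is kept.\<close>

lemma matrix_mult_entry_ge:
  fixes A B :: "real ^ 'n ^ 'n"
  assumes "row_stochastic A" "row_stochastic B"
  shows "A $ i $ k * B $ k $ j \<le> (A ** B) $ i $ j"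
  unfolding matrix_matrix_mult_def using assms
  by (auto simp: row_stochastic_def intro!: member_le_sum[of k UNIV "\<lambda>k. A $ i $ k * B $ k $ j"])

lemma transition_self: "transition A t t = mat 1"
  by (cases t) auto

lemma transition_split:
  assumes "\<tau> \<le> s" "s \<le> t"
  shows "transition A t \<tau> = transition A t s ** transition A s \<tau>"
  using assms(2)
proof (induction t)
  case 0
  then show ?case by simp
next
  case (Suc t)
  then show ?case
    using assms(1) by (cases "s = Suc t") (auto simp: matrix_mul_assoc[symmetric])
qed

lemma row_stochastic_transition:
  assumes "\<And>k. \<tau> < k \<Longrightarrow> row_stochastic (A k)"
  shows "row_stochastic (transition A t \<tau>)"
  by (induction t) (auto simp: assms row_stochastic_mat_1 row_stochastic_mult)

text \<open>The path that stays at \<open>i\<close> throughout uses \<open>t - \<tau>\<close>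
  self-loops, each of weight at least \<open>\<gamma>\<close>.\<close>

lemma transition_diag_ge:
  assumes "\<And>k. \<tau> < k \<Longrightarrow> row_stochastic (A k)" "\<And>k. \<tau> < k \<Longrightarrow> \<gamma> \<le> A k $ i $ i"
    and "0 \<le> \<gamma>" "\<tau> \<le> t"
  shows "\<gamma> ^ (t - \<tau>) \<le> transition A t \<tau> $ i $ i"
  using assms(4)
proof (induction t rule: dec_induct)
  case base
  then show ?case by (simp add: transition_self mat_def)
next
  case (step t)
  have "\<gamma> ^ (Suc t - \<tau>) = \<gamma> * \<gamma> ^ (t - \<tau>)" using step by (simp add: Suc_diff_le)
  also have "\<dots> \<le> A (Suc t) $ i $ i * transition A t \<tau> $ i $ i"
    using step assms by (intro mult_mono) (auto intro: order_trans[of 0 \<gamma>])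
  also have "\<dots> \<le> (A (Suc t) ** transition A t \<tau>) $ i $ i"
    using step assms by (intro matrix_mult_entry_ge row_stochastic_transition) auto
  finally show ?case using step by simp
qed

text \<open>The path stays at \<open>j\<close> before time \<open>k\<close>, moves to
  \<open>i\<close> at time \<open>k\<close> and stays there. The move takes one of the
  \<open>t - \<tau>\<close> factors, so \<open>t - \<tau> - 1\<close> self-loops remain.\<close>

lemma transition_entry_ge:
  assumes rs: "\<And>k. \<tau> < k \<Longrightarrow> row_stochastic (A k)"
    and diag: "\<And>k i. \<tau> < k \<Longrightarrow> \<gamma> \<le> A k $ i $ i"
    and "0 \<le> \<gamma>" "\<tau> < k" "k \<le> t"
  shows "\<gamma> ^ (t - \<tau> - 1) * A k $ i $ j \<le> transition A t \<tau> $ i $ j"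
proof -
  obtain s where k: "k = Suc s" "\<tau> \<le> s" using \<open>\<tau> < k\<close> by (cases k) auto
  have rs': "row_stochastic (transition A u v)" if "\<tau> \<le> v" for u v
    using that by (intro row_stochastic_transition rs) auto
  have A0: "0 \<le> A k $ i $ j" using rs[OF \<open>\<tau> < k\<close>] by (simp add: row_stochastic_def)
  have "\<gamma> ^ (t - \<tau> - 1) * A k $ i $ j = \<gamma> ^ (t - k) * (A k $ i $ j * \<gamma> ^ (s - \<tau>))"
    using k \<open>k \<le> t\<close> by (simp add: power_add[symmetric] algebra_simps)
  also have "\<dots> \<le> transition A t k $ i $ i * (A k $ i $ j * transition A s \<tau> $ j $ j)"
    using assms k A0 rs'[of k t]
    by (intro mult_mono transition_diag_ge) (auto simp: row_stochastic_def)
  also have "\<dots> \<le> transition A t k $ i $ i * (A k ** transition A s \<tau>) $ i $ j"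
    using rs'[of k t] \<open>\<tau> < k\<close> k
    by (intro mult_left_mono matrix_mult_entry_ge rs rs') (auto simp: row_stochastic_def)
  also have "A k ** transition A s \<tau> = transition A k \<tau>" using k by simp
  also have "transition A t k $ i $ i * transition A k \<tau> $ i $ j \<le>
      (transition A t k ** transition A k \<tau>) $ i $ j"
    using \<open>\<tau> < k\<close> by (intro matrix_mult_entry_ge rs') auto
  also have "\<dots> = transition A t \<tau> $ i $ j"
    using assms transition_split[of \<tau> k t A] by simp
  finally show ?thesis .
qed

lemma mat_diam_transition_split:
  assumes "\<And>k. \<tau> < k \<Longrightarrow> row_stochastic (A k)" "\<tau> \<le> s" "s \<le> t"
  shows "mat_diam (transition A t \<tau>) \<le> mat_diam (transition A t s) * mat_diam (transition A s \<tau>)"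
  unfolding transition_split[OF assms(2,3)]
  using assms by (intro mat_diam_mult_le row_stochastic_transition) auto

text \<open>The factors after time \<open>s\<close> form a stochastic matrix, of diameter at most 1,
  so submultiplicativity allows them to be dropped.\<close>

lemma mat_diam_transition_antimono:
  assumes "\<And>k. \<tau> < k \<Longrightarrow> row_stochastic (A k)" "\<tau> \<le> s" "s \<le> t"
  shows "mat_diam (transition A t \<tau>) \<le> mat_diam (transition A s \<tau>)"
proof -
  have "mat_diam (transition A t s) \<le> 1"
    using assms by (intro mat_diam_le_1 row_stochastic_transition) auto
  then show ?thesis
    using mat_diam_transition_split[of \<tau> A s t, OF assms]
      mult_right_mono[of "mat_diam (transition A t s)" 1 "mat_diam (transition A s \<tau>)"]
      mat_diam_nonneg by force
qed

subsection \<open>Reachability with thresholds\<close>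

text \<open>The column of \<open>P\<close> with index \<open>l\<close> records which vertices have been reached from \<open>l\<close>.
  For \<open>N > CARD('n) ^ 2\<close> only the first alternative below is possible.\<close>

definition spread :: "real \<Rightarrow> nat \<Rightarrow> real ^ 'n ^ 'n \<Rightarrow> bool" where
  "spread x N P \<longleftrightarrow> (\<exists>l. \<forall>i. x \<le> P $ i $ l) \<or> N \<le> card {p. x \<le> P $ fst p $ snd p}"

text \<open>The diagonal pairs supply the initial count for the induction over windows.\<close>

lemma spread_mat_1: "spread 1 CARD('n) (mat 1 :: real ^ 'n ^ 'n)"
proof -
  have "card (range (\<lambda>i::'n. (i, i))) \<le> card {p. 1 \<le> (mat 1 :: real ^ 'n ^ 'n) $ fst p $ snd p}"
    by (intro card_mono) (auto simp: mat_def)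
  then show ?thesis by (simp add: spread_def card_image inj_on_def)
qed

lemma spread_imp_column:
  fixes P :: "real ^ 'n ^ 'n"
  assumes "spread x N P" "CARD('n) ^ 2 < N"
  obtains l where "\<And>i. x \<le> P $ i $ l"
proof -
  have "card {p. x \<le> P $ fst p $ snd p} \<le> card (UNIV :: ('n \<times> 'n) set)"
    by (intro card_mono) auto
  also have "\<dots> < N" using assms(2) by (simp add: power2_eq_square)
  finally show thesis using assms(1) that unfolding spread_def by auto
qed

lemma mult_entry_ge_of_entries:
  fixes A P :: "real ^ 'n ^ 'n"
  assumes "row_stochastic A" "row_stochastic P" "0 \<le> x" "0 \<le> e" "e \<le> A $ i $ j" "x \<le> P $ j $ l"
  shows "e * x \<le> (A ** P) $ i $ l"
  using mult_mono[of e "A $ i $ j" x "P $ j $ l"] matrix_mult_entry_ge[of A P i j l] assms by linarith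

text \<open>The self-loop at \<open>i\<close> carries a marked pair \<open>(i, l)\<close> over to
  the product once the threshold is scaled by \<open>e\<close>. Hence neither a full column nor the
  count is lost.\<close>

lemma spread_mult:
  assumes "row_stochastic A" "row_stochastic P" "0 \<le> x" "0 \<le> e" "\<And>i. e \<le> A $ i $ i"
    and "spread x N P"
  shows "spread (e * x) N (A ** P)"
proof -
  have *: "e * x \<le> (A ** P) $ i $ l" if "x \<le> P $ i $ l" for i l
    using assms that by (intro mult_entry_ge_of_entries)
  then have "card {p. x \<le> P $ fst p $ snd p} \<le> card {p. e * x \<le> (A ** P) $ fst p $ snd p}"
    by (intro card_mono) auto
  with * assms(6) show ?thesis unfolding spread_def by (meson order_trans)
qed

text \<open>Besides the old pairs, kept by self-loops, the edge from \<open>j\<close> to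
  \<open>i\<close> marks the pair \<open>(i, l)\<close>, which was unmarked before; so the count
  rises strictly.\<close>

lemma spread_mult_grow:
  assumes "row_stochastic A" "row_stochastic P" "0 \<le> x" "0 \<le> e" "\<And>i. e \<le> A $ i $ i"
    and "N \<le> card {p. x \<le> P $ fst p $ snd p}"
    and "e \<le> A $ i $ j" "x \<le> P $ j $ l" "P $ i $ l < x"
  shows "spread (e * x) (Suc N) (A ** P)"
proof -
  have "e * x \<le> (A ** P) $ k $ m" if "x \<le> P $ k $ m" for k m
    using assms that by (intro mult_entry_ge_of_entries)
  moreover have "e * x \<le> (A ** P) $ i $ l"
    using assms by (intro mult_entry_ge_of_entries)
  ultimately have "{p. x \<le> P $ fst p $ snd p} \<subseteq> {p. e * x \<le> (A ** P) $ fst p $ snd p}"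
    and "(i, l) \<in> {p. e * x \<le> (A ** P) $ fst p $ snd p} - {p. x \<le> P $ fst p $ snd p}"
    using \<open>P $ i $ l < x\<close> by auto
  then have "{p. x \<le> P $ fst p $ snd p} \<subset> {p. e * x \<le> (A ** P) $ fst p $ snd p}"
    by blast
  then have "card {p. x \<le> P $ fst p $ snd p} < card {p. e * x \<le> (A ** P) $ fst p $ snd p}"
    by (intro psubset_card_mono) auto
  then show ?thesis using assms(6) unfolding spread_def by linarith
qed

text \<open>Column \<open>r\<close> of a root \<open>r\<close> is nonempty, so unless it is full an edge leaves it.\<close>

lemma rooted_tree_leaving_edge:
  fixes P :: "real ^ 'n ^ 'n"
  assumes "has_spanning_rooted_tree E" "\<And>i. x \<le> P $ i $ i" "\<not> (\<exists>l. \<forall>i. x \<le> P $ i $ l)"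
  obtains i j l where "(j, i) \<in> E" "x \<le> P $ j $ l" "P $ i $ l < x"
proof -
  obtain r where r: "\<And>v. (r, v) \<in> E\<^sup>*"
    using assms(1) unfolding has_spanning_rooted_tree_def by auto
  obtain v where v: "\<not> x \<le> P $ v $ r" using assms(3) by auto
  have "\<exists>j i. (j, i) \<in> E \<and> x \<le> P $ j $ r \<and> P $ i $ r < x"
  proof (rule ccontr)
    assume no: "\<not> ?thesis"
    have "x \<le> P $ v $ r"
      using r[of v]
    proof (induction rule: rtrancl_induct)
      case base
      show ?case by (rule assms(2))
    next
      case (step y z)
      then show ?case using no by (meson not_le)
    qed
    with v show False by simp
  qed
  then show thesis using that by blast
qed

section \<open>Measurability of the diameter and of the reachability events\<close>

lemma continuous_on_entry: "continuous_on S (\<lambda>A :: real ^ 'n ^ 'n. A $ i $ j)"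
  by (intro continuous_intros)

lemma borel_measurable_mat_diam:
  assumes "\<And>i j. (\<lambda>\<omega>. A \<omega> $ i $ j) \<in> borel_measurable N"
  shows "(\<lambda>\<omega>. mat_diam (A \<omega> :: real ^ 'n ^ 'n)) \<in> borel_measurable N"
proof -
  note [measurable] = assms
  have "(\<lambda>\<omega>. MAX p\<in>UNIV. (case p of (i, j) \<Rightarrow> 1 / 2 * (\<Sum>l\<in>UNIV. \<bar>A \<omega> $ i $ l - A \<omega> $ j $ l\<bar>)))
      \<in> borel_measurable N"
    by (rule borel_measurable_Max) (auto simp: case_prod_unfold)
  then show ?thesis unfolding mat_diam_def .
qed

lemma pred_spread:
  assumes "\<And>i j. (\<lambda>\<omega>. A \<omega> $ i $ j) \<in> borel_measurable N"
  shows "Measurable.pred N (\<lambda>\<omega>. N0 \<le> card {p. x \<le> (A \<omega> :: real ^ 'n ^ 'n) $ fst p $ snd p})"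
    and "Measurable.pred N (\<lambda>\<omega>. \<exists>l. \<forall>i. x \<le> A \<omega> $ i $ l)"
    and "Measurable.pred N (\<lambda>\<omega>. spread x N0 (A \<omega>))"
proof -
  note [measurable] = assms
  \<comment> \<open>Writing the cardinality as a finite sum of indicators reduces its measurability
    to that of the entries.\<close>
  have "(\<Sum>p\<in>UNIV. if x \<le> A \<omega> $ fst p $ snd p then 1 else 0) =
      real (card {p. x \<le> A \<omega> $ fst p $ snd p})" for \<omega>
    by (simp add: sum.If_cases)
  moreover have "Measurable.pred N
      (\<lambda>\<omega>. real N0 \<le> (\<Sum>p\<in>UNIV. if x \<le> A \<omega> $ fst p $ snd p then 1 else 0))"
    by measurable
  ultimately show [measurable]: "Measurable.pred N (\<lambda>\<omega>. N0 \<le> card {p. x \<le> A \<omega> $ fst p $ snd p})"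
    by (simp only: of_nat_le_iff)
  have "Measurable.pred N (\<lambda>\<omega>. \<exists>l\<in>UNIV. \<forall>i\<in>UNIV. x \<le> A \<omega> $ i $ l)"
    by (intro pred_intros_finite) auto
  then show [measurable]: "Measurable.pred N (\<lambda>\<omega>. \<exists>l. \<forall>i. x \<le> A \<omega> $ i $ l)"
    by simp
  show "Measurable.pred N (\<lambda>\<omega>. spread x N0 (A \<omega>))"
    unfolding spread_def by measurable
qed

subsection \<open>Conditional contraction\<close>

lemma borel_measurable_of_bool:
  "Measurable.pred N Q \<Longrightarrow> (\<lambda>\<omega>. of_bool (Q \<omega>) :: real) \<in> borel_measurable N"
  unfolding of_bool_def by measurable

lemma (in finite_measure) integrable_of_bool:
  "Measurable.pred M Q \<Longrightarrow> integrable M (\<lambda>\<omega>. of_bool (Q \<omega>) :: real)"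
  by (rule integrable_const_bound[where B = 1]) (auto intro: borel_measurable_of_bool)

text \<open>Fixing the data of the theorem here lets the constants be defined from
  \<open>\<gamma>\<close>, \<open>B\<close>, \<open>t\<^sub>0\<close> and the dimension alone, hence
  uniformly in all times.\<close>

locale adapted_stochastic = prob_space M for M :: "'a measure" +
  fixes F :: "nat \<Rightarrow> 'a measure" and W :: "nat \<Rightarrow> 'a \<Rightarrow> real ^ 'n ^ 'n"
    and t\<^sub>0 B :: nat and \<gamma> :: real
  assumes subalgebra_F: "\<And>t. subalgebra M (F t)"
    and filtration_F: "filtration (space M) F"
    and adapted: "\<And>t. W t \<in> borel_measurable (F t)"
    and stochastic: "\<And>t. t\<^sub>0 \<le> t \<Longrightarrow> AE \<omega> in M. row_stochastic (W t \<omega>)"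
    and \<gamma>_pos: "0 < \<gamma>" and \<gamma>_less_1: "\<gamma> < 1"
    and loops: "\<And>t. t\<^sub>0 \<le> t \<Longrightarrow> AE \<omega> in M. \<forall>i. (i, i) \<in> graph_edges \<gamma> (W t \<omega>)"
    and B_pos: "0 < B"
    and rooted: "\<And>t. t\<^sub>0 \<le> t \<Longrightarrow> AE \<omega> in M. has_spanning_rooted_tree (window_edges M F W \<gamma> B t \<omega>)"
begin

section \<open>Conditional expectations along the filtration\<close>

lemma sigma_finite_subalgebra_F: "sigma_finite_subalgebra M (F t)"
  using finite_measure_subalgebra_is_sigma_finite[of M "F t"] subalgebra_F
  by (simp add: finite_measure_subalgebra_def finite_measure_axioms finite_measure_subalgebra_axioms_def)

lemma subalgebra_F_mono: "s \<le> t \<Longrightarrow> subalgebra (F t) (F s)"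
  using filtration.sets_F_mono[OF filtration_F] filtration.space_F[OF filtration_F]
  by (simp add: subalgebra_def)

lemma measurable_F_mono: "f \<in> measurable (F s) N \<Longrightarrow> s \<le> t \<Longrightarrow> f \<in> measurable (F t) N"
  using measurable_from_subalg[OF subalgebra_F_mono] .

lemma measurable_F_M: "f \<in> measurable (F s) N \<Longrightarrow> f \<in> measurable M N"
  using measurable_from_subalg[OF subalgebra_F] .

text \<open>The tower property carries an estimate known at the later time \<open>u\<close> back to
  \<open>s\<close>. Upper bounds serve the diameters, lower bounds the growth events.\<close>

lemma cond_exp_tower_mono:
  assumes "s \<le> u" "integrable M X" "integrable M Y"
  shows "AE \<omega> in M. real_cond_exp M (F u) X \<omega> \<le> Y \<omega> \<Longrightarrow>
      AE \<omega> in M. real_cond_exp M (F s) X \<omega> \<le> real_cond_exp M (F s) Y \<omega>"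
    and "AE \<omega> in M. Y \<omega> \<le> real_cond_exp M (F u) X \<omega> \<Longrightarrow>
      AE \<omega> in M. real_cond_exp M (F s) Y \<omega> \<le> real_cond_exp M (F s) X \<omega>"
proof -
  interpret s: sigma_finite_subalgebra M "F s" by (rule sigma_finite_subalgebra_F)
  interpret u: sigma_finite_subalgebra M "F u" by (rule sigma_finite_subalgebra_F)
  have nest: "AE \<omega> in M. real_cond_exp M (F s) (real_cond_exp M (F u) X) \<omega> = real_cond_exp M (F s) X \<omega>"
    using assms by (intro s.real_cond_exp_nested_subalg subalgebra_F subalgebra_F_mono)
  have int: "integrable M (real_cond_exp M (F u) X)" using assms by (intro u.real_cond_exp_int)
  {
    assume "AE \<omega> in M. real_cond_exp M (F u) X \<omega> \<le> Y \<omega>"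
    from s.real_cond_exp_mono[OF this int assms(3)] nest
    show "AE \<omega> in M. real_cond_exp M (F s) X \<omega> \<le> real_cond_exp M (F s) Y \<omega>" by auto
  next
    assume "AE \<omega> in M. Y \<omega> \<le> real_cond_exp M (F u) X \<omega>"
    from s.real_cond_exp_mono[OF this assms(3) int] nest
    show "AE \<omega> in M. real_cond_exp M (F s) Y \<omega> \<le> real_cond_exp M (F s) X \<omega>" by auto
  }
qed

text \<open>Given \<open>F u\<close> the factor \<open>Y\<close> is known and can be pulled out, and
  its sign preserves the bound \<open>c\<close> on the other factor; the tower property then returns
  to \<open>F s\<close>. This is what peels off the later part of a product.\<close>

lemma cond_exp_mult_le:
  assumes "s \<le> u" "integrable M X" "integrable M Y" "integrable M (\<lambda>\<omega>. Y \<omega> * X \<omega>)"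
    and "Y \<in> borel_measurable (F u)" "\<And>\<omega>. 0 \<le> Y \<omega>"
    and le: "AE \<omega> in M. real_cond_exp M (F u) X \<omega> \<le> c"
  shows "AE \<omega> in M. real_cond_exp M (F s) (\<lambda>\<omega>. Y \<omega> * X \<omega>) \<omega> \<le> c * real_cond_exp M (F s) Y \<omega>"
proof -
  interpret s: sigma_finite_subalgebra M "F s" by (rule sigma_finite_subalgebra_F)
  interpret u: sigma_finite_subalgebra M "F u" by (rule sigma_finite_subalgebra_F)
  have "AE \<omega> in M. real_cond_exp M (F u) (\<lambda>\<omega>. Y \<omega> * X \<omega>) \<omega> = Y \<omega> * real_cond_exp M (F u) X \<omega>"
    using assms by (intro u.real_cond_exp_mult) auto
  with le have "AE \<omega> in M. real_cond_exp M (F u) (\<lambda>\<omega>. Y \<omega> * X \<omega>) \<omega> \<le> c * Y \<omega>"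
  proof eventually_elim
    case (elim \<omega>)
    then show ?case using mult_left_mono[OF elim(1) assms(6)[of \<omega>]] by (simp only: mult.commute[of c])
  qed
  then have "AE \<omega> in M. real_cond_exp M (F s) (\<lambda>\<omega>. Y \<omega> * X \<omega>) \<omega> \<le>
      real_cond_exp M (F s) (\<lambda>\<omega>. c * Y \<omega>) \<omega>"
    using assms by (intro cond_exp_tower_mono(1)) auto
  then show ?thesis using s.real_cond_exp_cmult[OF assms(3), of c] by eventually_elim simp
qed

section \<open>Regular sample paths and integrability of diameters\<close>

abbreviation Phi :: "nat \<Rightarrow> nat \<Rightarrow> 'a \<Rightarrow> real ^ 'n ^ 'n" where
  "Phi t \<tau> \<omega> \<equiv> transition (\<lambda>k. W k \<omega>) t \<tau>"

text \<open>Gathers the pathwise hypotheses for all of the countably many times into one event of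
  full measure, on which the deterministic matrix lemmas apply.\<close>

definition regular :: "'a \<Rightarrow> bool" where
  "regular \<omega> \<longleftrightarrow> (\<forall>t\<ge>t\<^sub>0. row_stochastic (W t \<omega>) \<and> (\<forall>i. \<gamma> \<le> W t \<omega> $ i $ i))"

lemma AE_regular: "AE \<omega> in M. regular \<omega>"
  unfolding regular_def AE_all_countable
proof
  fix t
  show "AE \<omega> in M. t\<^sub>0 \<le> t \<longrightarrow> row_stochastic (W t \<omega>) \<and> (\<forall>i. \<gamma> \<le> W t \<omega> $ i $ i)"
  proof (cases "t\<^sub>0 \<le> t")
    case True
    from stochastic[OF True] loops[OF True] show ?thesis
      by eventually_elim (auto simp: graph_edges_def intro: less_imp_le)
  qed simp
qed

lemma regular_row_stochastic: "regular \<omega> \<Longrightarrow> t\<^sub>0 \<le> \<tau> \<Longrightarrow> row_stochastic (Phi t \<tau> \<omega>)"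
  by (rule row_stochastic_transition) (simp add: regular_def)

lemma W_entry_measurable: "(\<lambda>\<omega>. W t \<omega> $ i $ j) \<in> borel_measurable (F t)"
  using measurable_compose[OF adapted borel_measurable_continuous_onI[OF continuous_on_entry]] .

lemma Phi_entry_measurable: "t \<le> s \<Longrightarrow> (\<lambda>\<omega>. Phi t \<tau> \<omega> $ i $ j) \<in> borel_measurable (F s)"
proof (induction t arbitrary: i j)
  case 0
  then show ?case by simp
next
  case (Suc t)
  have [measurable]: "(\<lambda>\<omega>. W (Suc t) \<omega> $ i $ j) \<in> borel_measurable (F s)" for i j
    using measurable_F_mono[OF W_entry_measurable] Suc.prems .
  have [measurable]: "(\<lambda>\<omega>. Phi t \<tau> \<omega> $ i $ j) \<in> borel_measurable (F s)" for i j
    using Suc by simp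
  show ?case by (cases "\<tau> \<le> t") (simp_all add: matrix_matrix_mult_def)
qed

lemma diam_measurable: "t \<le> s \<Longrightarrow> (\<lambda>\<omega>. mat_diam (Phi t \<tau> \<omega>)) \<in> borel_measurable (F s)"
  by (intro borel_measurable_mat_diam Phi_entry_measurable)

lemma diam_measurable_M: "(\<lambda>\<omega>. mat_diam (Phi t \<tau> \<omega>)) \<in> borel_measurable M"
  by (rule measurable_F_M[OF diam_measurable[OF order_refl]])

lemma AE_diam_le_1: "t\<^sub>0 \<le> \<tau> \<Longrightarrow> AE \<omega> in M. mat_diam (Phi t \<tau> \<omega>) \<le> 1"
  using AE_regular by eventually_elim (simp add: mat_diam_le_1 regular_row_stochastic)

lemma integrable_diam: "t\<^sub>0 \<le> \<tau> \<Longrightarrow> integrable M (\<lambda>\<omega>. mat_diam (Phi t \<tau> \<omega>))"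
  using AE_diam_le_1 diam_measurable_M
  by (intro integrable_const_bound[where B = 1]) (auto simp: mat_diam_nonneg)

lemma integrable_diam_mult:
  assumes "t\<^sub>0 \<le> \<tau>" "t\<^sub>0 \<le> \<tau>'"
  shows "integrable M (\<lambda>\<omega>. mat_diam (Phi t \<tau> \<omega>) * mat_diam (Phi t' \<tau>' \<omega>))"
proof (rule integrable_const_bound[where B = 1])
  show "AE \<omega> in M. norm (mat_diam (Phi t \<tau> \<omega>) * mat_diam (Phi t' \<tau>' \<omega>)) \<le> 1"
    using AE_diam_le_1[OF assms(1), of t] AE_diam_le_1[OF assms(2), of t']
    by eventually_elim (simp add: mat_diam_nonneg mult_le_one)
qed (intro borel_measurable_times diam_measurable_M)

section \<open>Growth of the reached sets in one window\<close>

definition \<eta> :: real where "\<eta> = \<gamma> ^ B / 2"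

text \<open>The same constant serves as the factor lost by the threshold in a window, through
  \<open>\<gamma> ^ B\<close> for the self-loops, and as the conditional success probability,
  through \<open>\<gamma> / 2\<close>.\<close>

lemma \<eta>_bounds: "0 < \<eta>" "\<eta> \<le> \<gamma> / 2" "\<eta> < 1 / 2" "\<eta> \<le> \<gamma> ^ B"
proof -
  show "0 < \<eta>" "\<eta> \<le> \<gamma> ^ B" using \<gamma>_pos by (auto simp: \<eta>_def)
  have "\<gamma> ^ B \<le> \<gamma> ^ 1" using \<gamma>_pos \<gamma>_less_1 B_pos by (intro power_decreasing) auto
  then show "\<eta> \<le> \<gamma> / 2" by (simp add: \<eta>_def)
  with \<gamma>_less_1 show "\<eta> < 1 / 2" by simp
qed

text \<open>The invariant for \<open>s\<close> windows started at time \<open>k * B\<close>: each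
  successful window adds a pair to the \<open>CARD('n)\<close> diagonal ones and costs a factor
  \<open>\<eta>\<close> in the threshold. A full column counts as success for any
  \<open>s\<close>.\<close>

definition grown :: "nat \<Rightarrow> nat \<Rightarrow> 'a \<Rightarrow> bool" where
  "grown k s \<omega> \<longleftrightarrow> spread (\<eta> ^ s) (CARD('n) + s) (Phi ((k + s) * B) (k * B) \<omega>)"

lemma integrable_of_bool_grown: "integrable M (\<lambda>\<omega>. of_bool (grown k s \<omega>) :: real)"
  unfolding grown_def
  by (rule integrable_of_bool[OF measurable_F_M[OF pred_spread(3)[OF Phi_entry_measurable[OF order_refl]]]])

lemma le_window_start:
  assumes "t\<^sub>0 \<le> k"
  shows "t\<^sub>0 \<le> k * B"
  using mult_le_mono[of t\<^sub>0 k 1 B] assms B_pos by simp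

text \<open>Given the past at the start of the new window, either a column is full and stays so, or
  the rooted tree supplies a leaving edge whose conditional mean weight exceeds
  \<open>\<gamma>\<close>. Since weights are at most 1, that edge is realised with sufficient weight
  with conditional probability at least \<open>\<gamma> / 2\<close>.\<close>

lemma cond_exp_grown_step:
  assumes "t\<^sub>0 \<le> k"
  shows "AE \<omega> in M. \<eta> * of_bool (grown k s \<omega>) \<le>
    real_cond_exp M (F ((k + s) * B)) (\<lambda>\<omega>. of_bool (grown k (Suc s) \<omega>)) \<omega>"
proof -
  define a x P where "a = (k + s) * B" and "x = \<eta> ^ s" and "P \<omega> = Phi a (k * B) \<omega>" for \<omega>
  define N where "N = CARD('n) + s"
  define A where "A \<omega> = Phi (a + B) a \<omega>" for \<omega>
  define Z where "Z = real_cond_exp M (F a) (\<lambda>\<omega>. of_bool (grown k (Suc s) \<omega>))"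
  interpret a: sigma_finite_subalgebra M "F a" by (rule sigma_finite_subalgebra_F)
  have kB: "t\<^sub>0 \<le> k * B" using assms by (rule le_window_start)
  have aB: "k * B \<le> a" "t\<^sub>0 \<le> a" "(k + Suc s) * B = a + B"
    using kB by (auto simp: a_def algebra_simps)
  have x: "0 \<le> x" using \<eta>_bounds by (simp add: x_def)
  have grown_s: "grown k s \<omega> \<longleftrightarrow> spread x N (P \<omega>)" for \<omega>
    by (simp add: grown_def a_def x_def P_def N_def)
  have grown_Suc: "grown k (Suc s) \<omega> \<longleftrightarrow> spread (\<eta> * x) (Suc N) (A \<omega> ** P \<omega>)" for \<omega>
    unfolding grown_def aB(3) A_def P_def N_def x_def
    using transition_split[of "k * B" a "a + B" "\<lambda>k. W k \<omega>"] aB by simp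
  have reg: "row_stochastic (A \<omega>)" "row_stochastic (P \<omega>)" "\<And>i. \<eta> \<le> A \<omega> $ i $ i"
      "\<And>i. x \<le> P \<omega> $ i $ i"
      "\<And>i j \<tau>. \<tau> \<in> {a + 1..a + B} \<Longrightarrow> \<gamma> ^ (B - 1) * W \<tau> \<omega> $ i $ j \<le> A \<omega> $ i $ j"
      "\<And>i j \<tau>. \<tau> \<in> {a + 1..a + B} \<Longrightarrow> W \<tau> \<omega> $ i $ j \<le> 1" if "regular \<omega>" for \<omega>
  proof -
    have W: "row_stochastic (W t \<omega>)" "\<gamma> \<le> W t \<omega> $ i $ i" if "t\<^sub>0 \<le> t" for t i
      using \<open>regular \<omega>\<close> that by (auto simp: regular_def)
    show "row_stochastic (A \<omega>)" "row_stochastic (P \<omega>)"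
      using regular_row_stochastic[OF that aB(2)] regular_row_stochastic[OF that kB]
      by (simp_all only: A_def P_def)
    show "\<eta> \<le> A \<omega> $ i $ i" for i
      using transition_diag_ge[of a "\<lambda>k. W k \<omega>" \<gamma> i "a + B"] W aB \<gamma>_pos \<eta>_bounds(4)
      by (force simp: A_def)
    \<comment> \<open>The self-loops of \<open>s\<close> windows keep all diagonal pairs marked, so
      that the column of the root is nonempty, as \<open>rooted_tree_leaving_edge\<close>
      requires.\<close>
    have "x \<le> (\<gamma> ^ B) ^ s"
      using \<eta>_bounds unfolding x_def by (intro power_mono) auto
    also have "\<dots> = \<gamma> ^ (a - k * B)"
      by (simp add: a_def add_mult_distrib power_mult[symmetric] mult.commute[of B])
    finally have "x \<le> \<gamma> ^ (a - k * B)" .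
    then show "x \<le> P \<omega> $ i $ i" for i
      using transition_diag_ge[of "k * B" "\<lambda>k. W k \<omega>" \<gamma> i a] W kB aB \<gamma>_pos
      by (force simp: P_def)
    show "\<gamma> ^ (B - 1) * W \<tau> \<omega> $ i $ j \<le> A \<omega> $ i $ j" if "\<tau> \<in> {a + 1..a + B}" for i j \<tau>
      using transition_entry_ge[of a "\<lambda>k. W k \<omega>" \<gamma> \<tau> "a + B" i j] W aB \<gamma>_pos that
      by (simp add: A_def)
    show "W \<tau> \<omega> $ i $ j \<le> 1" if "\<tau> \<in> {a + 1..a + B}" for i j \<tau>
      using W[of \<tau>] aB that member_le_sum[of j UNIV "\<lambda>j. W \<tau> \<omega> $ i $ j"]
      by (auto simp: row_stochastic_def)
  qed
  have meas_P: "(\<lambda>\<omega>. P \<omega> $ i $ j) \<in> borel_measurable (F a)" for i j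
    unfolding P_def by (rule Phi_entry_measurable) simp
  note [measurable] = this pred_spread(1,2)[of P, OF this]
  have [measurable]: "real_cond_exp M (F a) f \<in> borel_measurable (F a)" for f by simp
  have int: "integrable M (\<lambda>\<omega>. of_bool (grown k (Suc s) \<omega>) :: real)"
    by (rule integrable_of_bool_grown)
  have int01: "integrable M (\<lambda>\<omega>. of_bool (Q \<omega>) :: real)" if "Measurable.pred (F a) Q" for Q
    by (rule integrable_of_bool[OF measurable_F_M[OF that]])
  \<comment> \<open>A full column is already known at time \<open>a\<close>, and self-loops make
    success certain on that event.\<close>
  have full: "AE \<omega> in M. (\<exists>l. \<forall>i. x \<le> P \<omega> $ i $ l) \<longrightarrow> 1 \<le> Z \<omega>"
  proof -
    let ?Q = "\<lambda>\<omega>. of_bool (\<exists>l. \<forall>i. x \<le> P \<omega> $ i $ l) :: real"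
    have Q: "?Q \<in> borel_measurable (F a)"
      by (rule borel_measurable_of_bool[OF pred_spread(2)[OF meas_P]])
    have "AE \<omega> in M. ?Q \<omega> \<le> of_bool (grown k (Suc s) \<omega>)"
      using AE_regular
    proof eventually_elim
      case (elim \<omega>)
      have "spread (\<eta> * x) (Suc N) (A \<omega> ** P \<omega>)" if "\<exists>l. \<forall>i. x \<le> P \<omega> $ i $ l"
        using that reg[OF elim] x \<eta>_bounds by (intro spread_mult) (auto simp: spread_def)
      then show ?case by (auto simp: grown_Suc)
    qed
    then have "AE \<omega> in M. real_cond_exp M (F a) ?Q \<omega> \<le> Z \<omega>"
      unfolding Z_def by (intro a.real_cond_exp_mono int int01) auto
    moreover have "AE \<omega> in M. real_cond_exp M (F a) ?Q \<omega> = ?Q \<omega>"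
      using Q by (intro a.real_cond_exp_F_meas int01) auto
    ultimately show ?thesis
    proof eventually_elim
      case (elim \<omega>)
      then show ?case
        by (cases "\<exists>l. \<forall>i. x \<le> P \<omega> $ i $ l") (simp_all only: of_bool_eq simp_thms)
    qed
  qed
  \<comment> \<open>The indices are deterministic here, so that the event \<open>?R\<close> below is
    \<open>F a\<close>-measurable and its indicator can be pulled out. The random choice of the
    leaving edge comes only after the null sets are united.\<close>
  have edge: "AE \<omega> in M. real_cond_exp M (F a) (\<lambda>\<omega>. W \<tau> \<omega> $ i $ j) \<omega> > \<gamma> \<and>
      N \<le> card {p. x \<le> P \<omega> $ fst p $ snd p} \<and> x \<le> P \<omega> $ j $ l \<and> P \<omega> $ i $ l < x \<longrightarrow>
      \<eta> \<le> Z \<omega>" if \<tau>: "\<tau> \<in> {a + 1..a + B}" for i j l \<tau>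
  proof -
    let ?w = "\<lambda>\<omega>. W \<tau> \<omega> $ i $ j"
    let ?R = "\<lambda>\<omega>. real_cond_exp M (F a) ?w \<omega> > \<gamma> \<and>
      N \<le> card {p. x \<le> P \<omega> $ fst p $ snd p} \<and> x \<le> P \<omega> $ j $ l \<and> P \<omega> $ i $ l < x"
    let ?Q = "\<lambda>\<omega>. of_bool (?R \<omega>) :: real"
    have R [measurable]: "Measurable.pred (F a) ?R" by measurable
    then have Q: "?Q \<in> borel_measurable (F a)" by (rule borel_measurable_of_bool)
    have w [measurable]: "?w \<in> borel_measurable M" by (rule measurable_F_M[OF W_entry_measurable])
    have w01: "AE \<omega> in M. 0 \<le> ?w \<omega> \<and> ?w \<omega> \<le> 1"
      using AE_regular
    proof eventually_elim
      case (elim \<omega>)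
      then show ?case using reg(6)[OF elim \<tau>] \<tau> aB by (auto simp: regular_def row_stochastic_def)
    qed
    then have int_w: "integrable M ?w"
      by (intro integrable_const_bound[where B = 1]) auto
    have int_Qw: "integrable M (\<lambda>\<omega>. ?Q \<omega> * (?w \<omega> - \<gamma> / 2))"
    proof (rule integrable_const_bound[where B = 1])
      show "AE \<omega> in M. norm (?Q \<omega> * (?w \<omega> - \<gamma> / 2)) \<le> 1"
        using w01 by eventually_elim (use \<gamma>_pos \<gamma>_less_1 in auto)
    qed (use measurable_F_M[OF Q] in measurable)
    \<comment> \<open>As \<open>?w \<le> 1\<close>, the event \<open>\<gamma> / 2 < ?w\<close> has an indicator above \<open>?w - \<gamma> / 2\<close>, whose conditional
      expectation exceeds \<open>\<gamma> / 2 \<ge> \<eta>\<close> on \<open>?R\<close>.\<close>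
    have "AE \<omega> in M. ?Q \<omega> * (?w \<omega> - \<gamma> / 2) \<le> of_bool (grown k (Suc s) \<omega>)"
      using AE_regular
    proof eventually_elim
      case (elim \<omega>)
      have "grown k (Suc s) \<omega>" if "?R \<omega>" "\<gamma> / 2 < ?w \<omega>"
      proof -
        \<comment> \<open>One edge of weight at least \<open>\<gamma> / 2\<close> and
          \<open>B - 1\<close> self-loops make up the window.\<close>
        have "\<eta> = \<gamma> ^ (B - 1) * (\<gamma> / 2)"
          using B_pos by (simp add: \<eta>_def power_eq_if)
        also have "\<dots> \<le> \<gamma> ^ (B - 1) * ?w \<omega>"
          using that \<gamma>_pos by (intro mult_left_mono) auto
        also have "\<dots> \<le> A \<omega> $ i $ j" by (rule reg(5)[OF elim \<tau>])
        finally show ?thesis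
          unfolding grown_Suc using that reg[OF elim] x \<eta>_bounds(1)
          by (intro spread_mult_grow[where i = i and j = j and l = l]) auto
      qed
      \<comment> \<open>Off \<open>?R\<close> the left side vanishes, for
        \<open>?w \<omega> \<le> \<gamma> / 2\<close> it is nonpositive, and it never exceeds
        1.\<close>
      then show ?case using reg(6)[OF elim \<tau>, of i j] \<gamma>_pos
        by (cases "?R \<omega>"; cases "\<gamma> / 2 < ?w \<omega>"; cases "grown k (Suc s) \<omega>")
          (simp_all only: of_bool_eq, simp_all)
    qed
    then have "AE \<omega> in M. real_cond_exp M (F a) (\<lambda>\<omega>. ?Q \<omega> * (?w \<omega> - \<gamma> / 2)) \<omega> \<le> Z \<omega>"
      unfolding Z_def by (intro a.real_cond_exp_mono int int_Qw)
    moreover have "AE \<omega> in M. real_cond_exp M (F a) (\<lambda>\<omega>. ?Q \<omega> * (?w \<omega> - \<gamma> / 2)) \<omega> =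
        ?Q \<omega> * real_cond_exp M (F a) (\<lambda>\<omega>. ?w \<omega> - \<gamma> / 2) \<omega>"
      by (intro a.real_cond_exp_mult Q int_Qw) measurable
    moreover have "AE \<omega> in M. real_cond_exp M (F a) (\<lambda>\<omega>. ?w \<omega> - \<gamma> / 2) \<omega> =
        real_cond_exp M (F a) ?w \<omega> - real_cond_exp M (F a) (\<lambda>_. \<gamma> / 2) \<omega>"
      by (intro a.real_cond_exp_diff int_w) simp
    moreover have "AE \<omega> in M. real_cond_exp M (F a) (\<lambda>_. \<gamma> / 2) \<omega> = \<gamma> / 2"
      by (intro a.real_cond_exp_F_meas) auto
    ultimately show ?thesis
    proof eventually_elim
      case (elim \<omega>)
      then show ?case using \<eta>_bounds(2)
        by (cases "?R \<omega>") (simp_all only: of_bool_eq simp_thms, simp)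
    qed
  qed
  have nonneg: "AE \<omega> in M. 0 \<le> Z \<omega>"
    unfolding Z_def using int by (intro a.real_cond_exp_pos) auto
  \<comment> \<open>Finitely many indices leave a single null set, outside which the edge may depend
    on the sample point.\<close>
  have edges: "AE \<omega> in M. \<forall>\<tau>\<in>{a + 1..a + B}. \<forall>i j l.
      real_cond_exp M (F a) (\<lambda>\<omega>. W \<tau> \<omega> $ i $ j) \<omega> > \<gamma> \<and>
      N \<le> card {p. x \<le> P \<omega> $ fst p $ snd p} \<and> x \<le> P \<omega> $ j $ l \<and> P \<omega> $ i $ l < x \<longrightarrow>
      \<eta> \<le> Z \<omega>"
    by (intro AE_finite_allI eventually_all_finite allI edge) auto
  have "AE \<omega> in M. has_spanning_rooted_tree (window_edges M F W \<gamma> B (k + s) \<omega>)"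
    using assms by (intro rooted) simp
  with nonneg edges full AE_regular have "AE \<omega> in M. \<eta> * of_bool (grown k s \<omega>) \<le> Z \<omega>"
  proof eventually_elim
    case (elim \<omega>)
    have "\<eta> \<le> Z \<omega>" if "spread x N (P \<omega>)"
    proof (cases "\<exists>l. \<forall>i. x \<le> P \<omega> $ i $ l")
      case True
      then show ?thesis using elim \<eta>_bounds(3) by simp
    next
      case False
      obtain i j l where e: "(j, i) \<in> window_edges M F W \<gamma> B (k + s) \<omega>"
          "x \<le> P \<omega> $ j $ l" "P \<omega> $ i $ l < x"
        using rooted_tree_leaving_edge[OF elim(5) reg(4)[OF elim(4)] False] by blast
      \<comment> \<open>Window \<open>k + s\<close> thus consists of the times \<open>a + 1\<close>
        to \<open>a + B\<close>, and its graph is conditioned on \<open>F a\<close>.\<close>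
      have "(k + s + 1) * B = a + B" by (simp add: a_def)
      with e(1) obtain \<tau> where "\<tau> \<in> {a + 1..a + B}"
          "real_cond_exp M (F a) (\<lambda>\<omega>. W \<tau> \<omega> $ i $ j) \<omega> > \<gamma>"
        unfolding window_edges_def graph_edges_def mat_cond_exp_def a_def[symmetric]
        by (auto simp: add.commute)
      moreover have "N \<le> card {p. x \<le> P \<omega> $ fst p $ snd p}"
        using that False by (auto simp: spread_def)
      ultimately show ?thesis using e elim(2) by blast
    qed
    then show ?case using elim(1) by (auto simp: grown_s)
  qed
  then show ?thesis by (simp add: Z_def a_def)
qed

text \<open>The identity satisfies the invariant for \<open>s = 0\<close> surely; each further
  window costs a factor \<open>\<eta>\<close> of conditional probability by the tower
  property.\<close>

lemma cond_exp_grown: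
  assumes "t\<^sub>0 \<le> k"
  shows "AE \<omega> in M. \<eta> ^ s \<le> real_cond_exp M (F (k * B)) (\<lambda>\<omega>. of_bool (grown k s \<omega>)) \<omega>"
proof (induction s)
  case 0
  interpret k: sigma_finite_subalgebra M "F (k * B)" by (rule sigma_finite_subalgebra_F)
  have "grown k 0 \<omega>" for \<omega>
    by (simp add: grown_def transition_self spread_mat_1)
  then show ?case by (intro k.real_cond_exp_ge_c) auto
next
  case (Suc s)
  interpret k: sigma_finite_subalgebra M "F (k * B)" by (rule sigma_finite_subalgebra_F)
  have "AE \<omega> in M. real_cond_exp M (F (k * B)) (\<lambda>\<omega>. \<eta> * of_bool (grown k s \<omega>)) \<omega> \<le>
      real_cond_exp M (F (k * B)) (\<lambda>\<omega>. of_bool (grown k (Suc s) \<omega>)) \<omega>"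
    by (rule cond_exp_tower_mono(2)[OF _ _ _ cond_exp_grown_step[OF assms]])
      (auto intro: integrable_of_bool_grown)
  moreover have "AE \<omega> in M. real_cond_exp M (F (k * B)) (\<lambda>\<omega>. \<eta> * of_bool (grown k s \<omega>)) \<omega> =
      \<eta> * real_cond_exp M (F (k * B)) (\<lambda>\<omega>. of_bool (grown k s \<omega>)) \<omega>"
    by (intro k.real_cond_exp_cmult integrable_of_bool_grown)
  ultimately show ?case
    using Suc.IH
  proof eventually_elim
    case (elim \<omega>)
    then show ?case
      using mult_left_mono[OF elim(3) less_imp_le[OF \<eta>_bounds(1)]] unfolding power_Suc by linarith
  qed
qed

section \<open>Contraction over blocks of windows and geometric decay\<close>

definition m :: nat where "m = CARD('n) ^ 2"
text \<open>One factor \<open>\<eta> ^ m\<close> is the conditional probability of success over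
  \<open>m\<close> windows, the other the resulting lower bound on a column.\<close>

definition q :: real where "q = 1 - \<eta> ^ m * \<eta> ^ m"

lemma m_pos: "0 < m"
  by (simp add: m_def)

lemma q_bounds: "0 < q" "q < 1"
proof -
  have "\<eta> ^ m < 1" using \<eta>_bounds m_pos by (intro power_less_one_iff[THEN iffD2]) auto
  then have "\<eta> ^ m * \<eta> ^ m < 1 * 1" using \<eta>_bounds by (intro mult_strict_mono) auto
  then show "0 < q" by (simp add: q_def)
  show "q < 1" using \<eta>_bounds by (simp add: q_def)
qed

text \<open>On success the diameter is at most \<open>1 - \<eta> ^ m\<close>, otherwise at most 1;
  averaging with success probability at least \<open>\<eta> ^ m\<close> gives
  \<open>q\<close>.\<close>

lemma cond_exp_diam_block:
  assumes "t\<^sub>0 \<le> k"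
  shows "AE \<omega> in M. real_cond_exp M (F (k * B)) (\<lambda>\<omega>. mat_diam (Phi ((k + m) * B) (k * B) \<omega>)) \<omega> \<le> q"
proof -
  interpret k: sigma_finite_subalgebra M "F (k * B)" by (rule sigma_finite_subalgebra_F)
  let ?G = "\<lambda>\<omega>. of_bool (grown k m \<omega>) :: real"
  have kB: "t\<^sub>0 \<le> k * B" using assms by (rule le_window_start)
  have "AE \<omega> in M. mat_diam (Phi ((k + m) * B) (k * B) \<omega>) \<le> 1 - \<eta> ^ m * ?G \<omega>"
    using AE_regular
  proof eventually_elim
    case (elim \<omega>)
    have rs: "row_stochastic (Phi ((k + m) * B) (k * B) \<omega>)"
      using elim kB by (rule regular_row_stochastic)
    show ?case
    proof (cases "grown k m \<omega>")
      case True
      \<comment> \<open>The count would have to reach \<open>CARD('n) + m\<close>, which exceeds the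
        number \<open>m\<close> of all pairs, so a column is full.\<close>
      then obtain l where "\<And>i. \<eta> ^ m \<le> Phi ((k + m) * B) (k * B) \<omega> $ i $ l"
        unfolding grown_def by (rule spread_imp_column) (auto simp: m_def)
      then have "mat_diam (Phi ((k + m) * B) (k * B) \<omega>) \<le> 1 - \<eta> ^ m"
        using rs \<eta>_bounds by (intro mat_diam_le_of_column) auto
      then show ?thesis using True by simp
    qed (use mat_diam_le_1[OF rs] in simp)
  qed
  then have "AE \<omega> in M. real_cond_exp M (F (k * B)) (\<lambda>\<omega>. mat_diam (Phi ((k + m) * B) (k * B) \<omega>)) \<omega>
      \<le> real_cond_exp M (F (k * B)) (\<lambda>\<omega>. 1 - \<eta> ^ m * ?G \<omega>) \<omega>"
    using kB by (intro k.real_cond_exp_mono integrable_diam Bochner_Integration.integrable_diff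
        integrable_mult_right integrable_of_bool_grown) auto
  moreover have "AE \<omega> in M. real_cond_exp M (F (k * B)) (\<lambda>\<omega>. 1 - \<eta> ^ m * ?G \<omega>) \<omega> =
      real_cond_exp M (F (k * B)) (\<lambda>_. 1) \<omega> - real_cond_exp M (F (k * B)) (\<lambda>\<omega>. \<eta> ^ m * ?G \<omega>) \<omega>"
    by (intro k.real_cond_exp_diff) (auto intro: integrable_of_bool_grown)
  moreover have "AE \<omega> in M. real_cond_exp M (F (k * B)) (\<lambda>_. 1) \<omega> = 1"
    by (intro k.real_cond_exp_F_meas) auto
  moreover have "AE \<omega> in M. real_cond_exp M (F (k * B)) (\<lambda>\<omega>. \<eta> ^ m * ?G \<omega>) \<omega> =
      \<eta> ^ m * real_cond_exp M (F (k * B)) ?G \<omega>"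
    by (intro k.real_cond_exp_cmult integrable_of_bool_grown)
  ultimately show ?thesis
    using cond_exp_grown[OF assms, of m]
  proof eventually_elim
    case (elim \<omega>)
    have "\<eta> ^ m * \<eta> ^ m \<le> \<eta> ^ m * real_cond_exp M (F (k * B)) ?G \<omega>"
      using elim(5) \<eta>_bounds(1) by (intro mult_left_mono) auto
    then show ?case using elim unfolding q_def by linarith
  qed
qed

text \<open>The last block is peeled off: the product before it is known at its starting time, and
  the block contracts by \<open>q\<close> given that time. The stretch from \<open>\<tau>\<close> to
  the first window start is merely bounded by 1.\<close>

lemma cond_exp_diam_blocks:
  assumes "t\<^sub>0 \<le> k" "t\<^sub>0 \<le> \<tau>" "\<tau> \<le> k * B"
  shows "AE \<omega> in M. real_cond_exp M (F \<tau>) (\<lambda>\<omega>. mat_diam (Phi ((k + j * m) * B) \<tau> \<omega>)) \<omega> \<le> q ^ j"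
proof (induction j)
  case 0
  interpret t: sigma_finite_subalgebra M "F \<tau>" by (rule sigma_finite_subalgebra_F)
  show ?case using assms
    by (intro t.real_cond_exp_le_c integrable_diam) (auto intro: AE_diam_le_1)
next
  case (Suc j)
  interpret t: sigma_finite_subalgebra M "F \<tau>" by (rule sigma_finite_subalgebra_F)
  define k' where "k' = k + j * m"
  have k': "k + Suc j * m = k' + m" "t\<^sub>0 \<le> k'" "\<tau> \<le> k' * B"
    using assms by (auto simp: k'_def algebra_simps)
  have k'B: "t\<^sub>0 \<le> k' * B" using k'(2) by (rule le_window_start)
  let ?X = "\<lambda>\<omega>. mat_diam (Phi ((k' + m) * B) (k' * B) \<omega>)"
  let ?Y = "\<lambda>\<omega>. mat_diam (Phi (k' * B) \<tau> \<omega>)"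
  have "AE \<omega> in M. mat_diam (Phi ((k' + m) * B) \<tau> \<omega>) \<le> ?Y \<omega> * ?X \<omega>"
    using AE_regular
  proof eventually_elim
    case (elim \<omega>)
    then show ?case
      using mat_diam_transition_split[of \<tau> "\<lambda>k. W k \<omega>" "k' * B" "(k' + m) * B"] assms k'
      by (simp add: regular_def mult.commute)
  qed
  then have "AE \<omega> in M. real_cond_exp M (F \<tau>) (\<lambda>\<omega>. mat_diam (Phi ((k' + m) * B) \<tau> \<omega>)) \<omega> \<le>
      real_cond_exp M (F \<tau>) (\<lambda>\<omega>. ?Y \<omega> * ?X \<omega>) \<omega>"
    using assms k'B by (intro t.real_cond_exp_mono integrable_diam integrable_diam_mult)
  moreover have "AE \<omega> in M. real_cond_exp M (F \<tau>) (\<lambda>\<omega>. ?Y \<omega> * ?X \<omega>) \<omega> \<le>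
      q * real_cond_exp M (F \<tau>) ?Y \<omega>"
    using assms k' k'B
    by (intro cond_exp_mult_le[where u = "k' * B"] integrable_diam integrable_diam_mult diam_measurable
        cond_exp_diam_block) (auto simp: mat_diam_nonneg)
  ultimately show ?case
    using Suc.IH unfolding k'(1) k'_def[symmetric]
  proof eventually_elim
    case (elim \<omega>)
    then show ?case
      using mult_left_mono[OF elim(3) less_imp_le[OF q_bounds(1)]] unfolding power_Suc by linarith
  qed
qed

text \<open>A block of \<open>m\<close> windows contracts by \<open>q\<close>, so a single step by \<open>\<rho>\<^sup>2\<close>; \<open>D\<close> bounds the number of
  steps outside complete blocks.\<close>

definition \<rho> :: real where "\<rho> = root (2 * m * B) q"
definition D :: nat where "D = t\<^sub>0 * B + B + m * B"
definition C :: real where "C = 1 / \<rho> ^ (2 * D)"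

lemma \<rho>_bounds: "0 < \<rho>" "\<rho> < 1"
  using q_bounds m_pos B_pos by (auto simp: \<rho>_def)

lemma C_ge_1: "1 \<le> C"
  using \<rho>_bounds by (simp add: C_def power_le_one)

text \<open>All but at most \<open>D\<close> of the \<open>t - \<tau>\<close> steps lie in complete
  blocks, and \<open>C\<close> pays for the rest.\<close>

lemma cond_exp_diam:
  assumes "t\<^sub>0 \<le> \<tau>" "\<tau> \<le> t"
  shows "AE \<omega> in M. real_cond_exp M (F \<tau>) (\<lambda>\<omega>. mat_diam (Phi t \<tau> \<omega>)) \<omega> \<le> C * \<rho> ^ (2 * (t - \<tau>))"
proof -
  interpret t: sigma_finite_subalgebra M "F \<tau>" by (rule sigma_finite_subalgebra_F)
  \<comment> \<open>The window index itself must be at least \<open>t\<^sub>0\<close>, and its start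
    must not precede \<open>\<tau>\<close>. This delays the first block by at most
    \<open>t\<^sub>0 * B + B\<close> steps; an incomplete last block has fewer than
    \<open>m * B\<close>.\<close>
  define k where "k = t\<^sub>0 + \<tau> div B + 1"
  define j where "j = (t - k * B) div (m * B)"
  have "\<tau> < (\<tau> div B + 1) * B" using B_pos dividend_less_div_times[of B \<tau>] by simp
  then have k: "t\<^sub>0 \<le> k" "\<tau> \<le> k * B" by (auto simp: k_def algebra_simps)
  have kD: "k * B \<le> \<tau> + t\<^sub>0 * B + B" by (simp add: k_def algebra_simps)
  have mB: "0 < m * B" using m_pos B_pos by simp
  have "t - k * B < j * (m * B) + m * B"
    unfolding j_def using mB dividend_less_div_times[of "m * B" "t - k * B"] by simp
  then have jD: "t - \<tau> \<le> m * B * j + D" using kD by (simp add: D_def algebra_simps)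
  have "\<rho> ^ (2 * (m * B * j + D)) \<le> \<rho> ^ (2 * (t - \<tau>))"
    using jD \<rho>_bounds by (intro power_decreasing) auto
  moreover have "\<rho> ^ (2 * (m * B * j + D)) = q ^ j * \<rho> ^ (2 * D)"
  proof -
    have "\<rho> ^ (2 * m * B) = q" unfolding \<rho>_def using q_bounds mB by (intro real_root_pow_pos2) auto
    then have "q ^ j = \<rho> ^ (2 * (m * B * j))" by (metis mult.assoc power_mult)
    then show ?thesis by (simp add: power_add[symmetric] algebra_simps)
  qed
  ultimately have "q ^ j * \<rho> ^ (2 * D) \<le> \<rho> ^ (2 * (t - \<tau>))" by simp
  then have qj: "q ^ j \<le> C * \<rho> ^ (2 * (t - \<tau>))"
    using \<rho>_bounds by (simp add: C_def pos_le_divide_eq)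
  have "AE \<omega> in M. real_cond_exp M (F \<tau>) (\<lambda>\<omega>. mat_diam (Phi t \<tau> \<omega>)) \<omega> \<le> q ^ j"
  \<comment> \<open>Subtraction is truncated, so \<open>j = 0\<close> also covers
    \<open>t < k * B\<close>; only a positive \<open>j\<close> ensures that the blocks end by time
    \<open>t\<close>.\<close>
  proof (cases "j = 0")
    case True
    then show ?thesis using assms
      by (auto intro: t.real_cond_exp_le_c integrable_diam AE_diam_le_1)
  next
    case False
    have "j * (m * B) \<le> t - k * B" unfolding j_def by simp
    moreover have "0 < j * (m * B)" using False mB by simp
    ultimately have "k * B + j * (m * B) \<le> t" by linarith
    then have le: "(k + j * m) * B \<le> t" by (simp add: algebra_simps)
    have ge: "\<tau> \<le> (k + j * m) * B" using k by (simp add: algebra_simps)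
    have "AE \<omega> in M. mat_diam (Phi t \<tau> \<omega>) \<le> mat_diam (Phi ((k + j * m) * B) \<tau> \<omega>)"
      using AE_regular
      by eventually_elim
        (use assms le ge in \<open>auto simp: regular_def intro!: mat_diam_transition_antimono\<close>)
    then have "AE \<omega> in M. real_cond_exp M (F \<tau>) (\<lambda>\<omega>. mat_diam (Phi t \<tau> \<omega>)) \<omega> \<le>
        real_cond_exp M (F \<tau>) (\<lambda>\<omega>. mat_diam (Phi ((k + j * m) * B) \<tau> \<omega>)) \<omega>"
      using assms by (intro t.real_cond_exp_mono integrable_diam)
    then show ?thesis
      using cond_exp_diam_blocks[OF k(1) assms(1) k(2), of j] by eventually_elim simp
  qed
  then show ?thesis using qj by auto
qed

text \<open>The two interval lengths add up to at most twice the length of the union. Counting each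
  step of the union once at rate \<open>\<rho>\<^sup>2\<close> therefore yields rate
  \<open>\<rho>\<close> for both intervals.\<close>

lemma cond_exp_diam_mult:
  assumes "t\<^sub>0 \<le> \<tau>\<^sub>1" "\<tau>\<^sub>1 \<le> t\<^sub>1" "\<tau>\<^sub>1 \<le> \<tau>\<^sub>2" "\<tau>\<^sub>2 \<le> t\<^sub>2"
  shows "AE \<omega> in M. real_cond_exp M (F \<tau>\<^sub>1)
      (\<lambda>\<omega>. mat_diam (Phi t\<^sub>2 \<tau>\<^sub>2 \<omega>) * mat_diam (Phi t\<^sub>1 \<tau>\<^sub>1 \<omega>)) \<omega> \<le>
    C\<^sup>2 * \<rho> ^ (t\<^sub>1 - \<tau>\<^sub>1) * \<rho> ^ (t\<^sub>2 - \<tau>\<^sub>2)"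
proof -
  interpret t: sigma_finite_subalgebra M "F \<tau>\<^sub>1" by (rule sigma_finite_subalgebra_F)
  let ?d2 = "\<lambda>\<omega>. mat_diam (Phi t\<^sub>2 \<tau>\<^sub>2 \<omega>)" and ?d1 = "\<lambda>\<omega>. mat_diam (Phi t\<^sub>1 \<tau>\<^sub>1 \<omega>)"
  have \<tau>2: "t\<^sub>0 \<le> \<tau>\<^sub>2" using assms by simp
  have dec: "c * \<rho> ^ e \<le> C\<^sup>2 * \<rho> ^ (t\<^sub>1 - \<tau>\<^sub>1) * \<rho> ^ (t\<^sub>2 - \<tau>\<^sub>2)"
    if "(t\<^sub>1 - \<tau>\<^sub>1) + (t\<^sub>2 - \<tau>\<^sub>2) \<le> e" "c \<le> C\<^sup>2" for c e
    unfolding mult.assoc power_add[symmetric]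
    using that \<rho>_bounds by (intro mult_mono power_decreasing) auto
  show ?thesis
  proof (cases "t\<^sub>1 \<le> \<tau>\<^sub>2 \<or> t\<^sub>1 \<le> t\<^sub>2")
    case True
    \<comment> \<open>The first product is cut at the start of the second, which makes it known at
      time \<open>\<tau>\<^sub>2\<close>; the discarded overlap is covered by the second
      product.\<close>
    define s where "s = min t\<^sub>1 \<tau>\<^sub>2"
    have s: "\<tau>\<^sub>1 \<le> s" "s \<le> t\<^sub>1" "s \<le> \<tau>\<^sub>2" using assms by (auto simp: s_def)
    let ?Y = "\<lambda>\<omega>. mat_diam (Phi s \<tau>\<^sub>1 \<omega>)"
    have exponent: "(C * \<rho> ^ (2 * (t\<^sub>2 - \<tau>\<^sub>2))) * (C * \<rho> ^ (2 * (s - \<tau>\<^sub>1))) \<le>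
        C\<^sup>2 * \<rho> ^ (t\<^sub>1 - \<tau>\<^sub>1) * \<rho> ^ (t\<^sub>2 - \<tau>\<^sub>2)"
    proof -
      have "(C * \<rho> ^ (2 * (t\<^sub>2 - \<tau>\<^sub>2))) * (C * \<rho> ^ (2 * (s - \<tau>\<^sub>1))) =
          C\<^sup>2 * \<rho> ^ (2 * (t\<^sub>2 - \<tau>\<^sub>2) + 2 * (s - \<tau>\<^sub>1))"
        by (simp add: power_add power2_eq_square)
      moreover have "(t\<^sub>1 - \<tau>\<^sub>1) + (t\<^sub>2 - \<tau>\<^sub>2) \<le> 2 * (t\<^sub>2 - \<tau>\<^sub>2) + 2 * (s - \<tau>\<^sub>1)"
        using True assms by (auto simp: s_def min_def)
      ultimately show ?thesis using dec by simp
    qed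
    have "AE \<omega> in M. ?d2 \<omega> * ?d1 \<omega> \<le> ?Y \<omega> * ?d2 \<omega>"
      using AE_regular
    proof eventually_elim
      case (elim \<omega>)
      have "?d1 \<omega> \<le> ?Y \<omega>"
        using elim assms s by (intro mat_diam_transition_antimono) (auto simp: regular_def)
      then show ?case by (subst mult.commute) (intro mult_right_mono mat_diam_nonneg)
    qed
    then have "AE \<omega> in M. real_cond_exp M (F \<tau>\<^sub>1) (\<lambda>\<omega>. ?d2 \<omega> * ?d1 \<omega>) \<omega> \<le>
        real_cond_exp M (F \<tau>\<^sub>1) (\<lambda>\<omega>. ?Y \<omega> * ?d2 \<omega>) \<omega>"
      using assms \<tau>2 by (intro t.real_cond_exp_mono integrable_diam_mult)
    moreover have "AE \<omega> in M. real_cond_exp M (F \<tau>\<^sub>1) (\<lambda>\<omega>. ?Y \<omega> * ?d2 \<omega>) \<omega> \<le>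
        (C * \<rho> ^ (2 * (t\<^sub>2 - \<tau>\<^sub>2))) * real_cond_exp M (F \<tau>\<^sub>1) ?Y \<omega>"
      using assms \<tau>2 s
      by (intro cond_exp_mult_le[where u = \<tau>\<^sub>2] integrable_diam integrable_diam_mult
          diam_measurable cond_exp_diam) (auto simp: mat_diam_nonneg)
    moreover have "AE \<omega> in M. real_cond_exp M (F \<tau>\<^sub>1) ?Y \<omega> \<le> C * \<rho> ^ (2 * (s - \<tau>\<^sub>1))"
      using assms s by (intro cond_exp_diam)
    ultimately show ?thesis
    proof eventually_elim
      case (elim \<omega>)
      have "(C * \<rho> ^ (2 * (t\<^sub>2 - \<tau>\<^sub>2))) * real_cond_exp M (F \<tau>\<^sub>1) ?Y \<omega> \<le>
          (C * \<rho> ^ (2 * (t\<^sub>2 - \<tau>\<^sub>2))) * (C * \<rho> ^ (2 * (s - \<tau>\<^sub>1)))"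
        using elim(3) C_ge_1 \<rho>_bounds by (intro mult_left_mono) auto
      then show ?case using elim exponent by linarith
    qed
  next
    case False
    \<comment> \<open>Now the second interval lies inside the first, so its diameter is bounded by 1
      and the first product supplies all the decay.\<close>
    have "AE \<omega> in M. ?d2 \<omega> * ?d1 \<omega> \<le> ?d1 \<omega>"
      using AE_diam_le_1[OF \<tau>2, of t\<^sub>2]
      by eventually_elim (simp add: mult_left_le_one_le mat_diam_nonneg)
    then have "AE \<omega> in M. real_cond_exp M (F \<tau>\<^sub>1) (\<lambda>\<omega>. ?d2 \<omega> * ?d1 \<omega>) \<omega> \<le>
        real_cond_exp M (F \<tau>\<^sub>1) ?d1 \<omega>"
      using assms \<tau>2 by (intro t.real_cond_exp_mono integrable_diam_mult integrable_diam)
    moreover have "AE \<omega> in M. real_cond_exp M (F \<tau>\<^sub>1) ?d1 \<omega> \<le> C * \<rho> ^ (2 * (t\<^sub>1 - \<tau>\<^sub>1))"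
      using assms by (intro cond_exp_diam)
    moreover have "C * \<rho> ^ (2 * (t\<^sub>1 - \<tau>\<^sub>1)) \<le> C\<^sup>2 * \<rho> ^ (t\<^sub>1 - \<tau>\<^sub>1) * \<rho> ^ (t\<^sub>2 - \<tau>\<^sub>2)"
      using False assms C_ge_1 by (intro dec) (auto simp: power2_eq_square)
    ultimately show ?thesis by auto
  qed
qed

end

theorem lemma5:
  fixes M :: "'a measure" and F :: "nat \<Rightarrow> 'a measure"
    and W :: "nat \<Rightarrow> 'a \<Rightarrow> real ^ 'n ^ 'n"
    and t\<^sub>0 B :: nat and \<gamma> :: real
  assumes "prob_space M"
    and "\<And>t. subalgebra M (F t)"
    and "filtration (space M) F"
    and "\<And>t. W t \<in> borel_measurable (F t)"
    and "\<And>t. t\<^sub>0 \<le> t \<Longrightarrow> AE \<omega> in M. row_stochastic (W t \<omega>)"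
    and "0 < \<gamma>" and "\<gamma> < 1"
    and "\<And>t. t\<^sub>0 \<le> t \<Longrightarrow> AE \<omega> in M. \<forall>i. (i, i) \<in> graph_edges \<gamma> (W t \<omega>)"
    and "0 < B"
    and "\<And>t. t\<^sub>0 \<le> t \<Longrightarrow> AE \<omega> in M. has_spanning_rooted_tree (window_edges M F W \<gamma> B t \<omega>)"
  shows "\<exists>C \<rho>. 0 < C \<and> 0 \<le> \<rho> \<and> \<rho> < 1 \<and>
    (\<forall>\<tau>\<^sub>1 t\<^sub>1 \<tau>\<^sub>2 t\<^sub>2. t\<^sub>0 \<le> \<tau>\<^sub>1 \<and> \<tau>\<^sub>1 \<le> t\<^sub>1 \<and> t\<^sub>0 \<le> \<tau>\<^sub>2 \<and> \<tau>\<^sub>2 \<le> t\<^sub>2 \<and> \<tau>\<^sub>1 \<le> \<tau>\<^sub>2 \<longrightarrow>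
      (AE \<omega> in M.
        real_cond_exp M (F \<tau>\<^sub>1)
          (\<lambda>\<omega>'. mat_diam (transition (\<lambda>t. W t \<omega>') t\<^sub>2 \<tau>\<^sub>2) *
                mat_diam (transition (\<lambda>t. W t \<omega>') t\<^sub>1 \<tau>\<^sub>1)) \<omega>
        \<le> C * \<rho> ^ (t\<^sub>1 - \<tau>\<^sub>1) * \<rho> ^ (t\<^sub>2 - \<tau>\<^sub>2)))"
proof -
  interpret adapted_stochastic M F W t\<^sub>0 B \<gamma>
    using assms by (intro adapted_stochastic.intro adapted_stochastic_axioms.intro)
  show ?thesis
  proof (intro exI conjI allI impI)
    \<comment> \<open>These goals fix the witnesses; the square comes from one factor
      \<open>C\<close> for each of the two products.\<close>
    show "0 < C\<^sup>2" "0 \<le> \<rho>" "\<rho> < 1" using C_ge_1 \<rho>_bounds by auto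
  qed (intro cond_exp_diam_mult; simp)
qed

end
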